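(* Let $G = {\rm C}_{2}^{2} \rtimes {\rm C}_{4}$ be the group of order $16$ with presentation $$G = \langle g_{1}, g_{2}, g_{3} \mid g_{1}^{2} = g_{2}^{2} = g_{3}^{4} = e, \ g_{1} g_{2} = g_{2} g_{1}, \ g_{1} g_{3} = g_{3} g_{1}, \ g_{2} g_{3} = g_{3} g_{2} g_{1} \rangle,$$ where $e$ is the unit element. Let $S(G)$ be the set of all values of the group determinant of $G$ at integer arguments. Then $$S({\rm C}_{2}^{2} \rtimes {\rm C}_{4}) = \{ 16 m + 1 \mid m \in \mathbb{Z} \} \cup 2^{14} \mathbb{Z}.$$
   Context: For a finite group $G$ and indeterminates $x_{g}$ ($g \in G$), the group determinant of $G$ is $\Theta_{G}(x_{g}) := \det\left( x_{g h^{-1}} \right)_{g, h \in G} \in \mathbb{Z}[x_{g}]$, the determinant of the matrix with rows and columns indexed by $G$ whose $(g,h)$ entry is $x_{gh^{-1}}$. The set of achievable integer values is $S(G) := \{ \Theta_{G}(x_{g}) \mid x_{g} \in \mathbb{Z} \text{ for all } g \in G \}$. The notation $2^{14}\mathbb{Z}$ means the set of all integer multiples of $2^{14}$. *)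

theory Defs
  imports "HOL-Algebra.Coset" "HOL-Analysis.Determinants"
begin

section \<open>Group determinants\<close>

text \<open>
  The library determinants are indexed by a finite type or by an initial segment of the
  naturals.  Here the index set is the carrier of a group, so the Leibniz formula is stated
  for an arbitrary finite index set.
\<close>

definition det_on :: "'i set \<Rightarrow> ('i \<Rightarrow> 'i \<Rightarrow> 'r) \<Rightarrow> 'r::comm_ring_1" where
  "det_on I M = (\<Sum>p | p permutes I. of_int (sign p) * (\<Prod>i\<in>I. M i (p i)))"

lemma det_on_UNIV: "det_on UNIV (\<lambda>i j. A $ i $ j) = det A"
  by (simp add: det_on_def det_def)

text \<open>
  The value of the group determinant polynomial at the point \<open>x\<close> of an arbitrary commutative
  ring.  Only the values of \<open>x\<close> on the carrier matter; \<open>G\<close> is meant to be finite.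
\<close>

definition group_det :: "('g, 'm) monoid_scheme \<Rightarrow> ('g \<Rightarrow> 'r) \<Rightarrow> 'r::comm_ring_1" where
  "group_det G x = det_on (carrier G) (\<lambda>g h. x (g \<otimes>\<^bsub>G\<^esub> inv\<^bsub>G\<^esub> h))"

definition integer_group_dets :: "('g, 'm) monoid_scheme \<Rightarrow> int set" where
  "integer_group_dets G = {group_det G x |x :: 'g \<Rightarrow> int. True}"


section \<open>Groups given by generators and relations\<close>

text \<open>
  Words are lists of letters; \<open>(a, True)\<close> stands for the generator \<open>a\<close> and \<open>(a, False)\<close> for
  its inverse.  All elements of the type \<open>'a\<close> are generators, and a relation \<open>u = v\<close> is the
  pair \<open>(u, v)\<close>.
\<close>

type_synonym 'a word = "('a \<times> bool) list"

inductive word_cong :: "('a word \<times> 'a word) set \<Rightarrow> 'a word \<Rightarrow> 'a word \<Rightarrow> bool"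
  for R where
  rel: "(u, v) \<in> R \<Longrightarrow> word_cong R u v"
| cancel: "word_cong R [(a, s), (a, \<not> s)] []"
| refl: "word_cong R u u"
| sym: "word_cong R u v \<Longrightarrow> word_cong R v u"
| trans: "word_cong R u v \<Longrightarrow> word_cong R v w \<Longrightarrow> word_cong R u w"
| append: "word_cong R u u' \<Longrightarrow> word_cong R v v' \<Longrightarrow> word_cong R (u @ v) (u' @ v')"

definition word_class :: "('a word \<times> 'a word) set \<Rightarrow> 'a word \<Rightarrow> 'a word set" where
  "word_class R u = {v. word_cong R u v}"

definition presented_group :: "('a word \<times> 'a word) set \<Rightarrow> 'a word set monoid" where
  "presented_group R =
     \<lparr>carrier = range (word_class R),
      monoid.mult = (\<lambda>U V. \<Union>u\<in>U. \<Union>v\<in>V. word_class R (u @ v)),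
      monoid.one = word_class R []\<rparr>"

lemma word_class_eq_iff: "word_class R u = word_class R v \<longleftrightarrow> word_cong R u v"
proof
  assume "word_class R u = word_class R v"
  moreover have "word_cong R v v" by (rule word_cong.refl)
  ultimately show "word_cong R u v" by (auto simp: word_class_def)
next
  assume "word_cong R u v"
  then have "word_cong R u w \<longleftrightarrow> word_cong R v w" for w
    using word_cong.sym word_cong.trans by blast
  then show "word_class R u = word_class R v" by (simp add: word_class_def)
qed

lemma presented_group_mult:
  "word_class R u \<otimes>\<^bsub>presented_group R\<^esub> word_class R v = word_class R (u @ v)"
proof -
  have "word_class R (u' @ v') = word_class R (u @ v)"
    if "u' \<in> word_class R u" "v' \<in> word_class R v" for u' v'
    using word_cong.sym[OF word_cong.append[of R u u' v v']] that
    by (simp add: word_class_eq_iff) (simp add: word_class_def)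
  moreover have "u \<in> word_class R u" "v \<in> word_class R v"
    by (simp_all add: word_class_def word_cong.refl)
  ultimately have "(\<Union>u'\<in>word_class R u. \<Union>v'\<in>word_class R v. word_class R (u' @ v')) =
      word_class R (u @ v)"
    by blast
  then show ?thesis
    by (simp add: presented_group_def)
qed

lemma word_cong_inverse: "word_cong R (map (\<lambda>(a, s). (a, \<not> s)) (rev u) @ u) []"
proof (induction u)
  case Nil
  show ?case by (simp add: word_cong.refl)
next
  case (Cons l u)
  obtain a s where l: "l = (a, s)" by force
  let ?u = "map (\<lambda>(a, s). (a, \<not> s)) (rev u)"
  have "word_cong R (?u @ [(a, \<not> s), (a, \<not> \<not> s)] @ u) (?u @ [] @ u)"
    by (intro word_cong.append word_cong.refl word_cong.cancel)
  from word_cong.trans[OF this] Cons show ?case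
    by (simp add: l)
qed

lemma group_presented_group: "group (presented_group R)"
proof (rule groupI)
  fix x assume "x \<in> carrier (presented_group R)"
  then obtain u where x: "x = word_class R u" by (auto simp: presented_group_def)
  let ?y = "word_class R (map (\<lambda>(a, s). (a, \<not> s)) (rev u))"
  have "?y \<otimes>\<^bsub>presented_group R\<^esub> x = \<one>\<^bsub>presented_group R\<^esub>"
    unfolding x presented_group_mult by (simp add: presented_group_def word_class_eq_iff word_cong_inverse)
  then show "\<exists>y\<in>carrier (presented_group R). y \<otimes>\<^bsub>presented_group R\<^esub> x = \<one>\<^bsub>presented_group R\<^esub>"
    by (intro bexI[of _ ?y]) (auto simp: presented_group_def)
next
  fix x assume "x \<in> carrier (presented_group R)"
  then obtain u where x: "x = word_class R u" by (auto simp: presented_group_def)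
  have "word_class R [] \<otimes>\<^bsub>presented_group R\<^esub> word_class R u = word_class R u"
    by (simp add: presented_group_mult)
  then show "\<one>\<^bsub>presented_group R\<^esub> \<otimes>\<^bsub>presented_group R\<^esub> x = x"
    by (simp add: x presented_group_def)
next
  fix x y z
  assume "x \<in> carrier (presented_group R)" "y \<in> carrier (presented_group R)"
    "z \<in> carrier (presented_group R)"
  then obtain u v w where "x = word_class R u" "y = word_class R v" "z = word_class R w"
    by (auto simp: presented_group_def)
  then show "x \<otimes>\<^bsub>presented_group R\<^esub> y \<otimes>\<^bsub>presented_group R\<^esub> z =
      x \<otimes>\<^bsub>presented_group R\<^esub> (y \<otimes>\<^bsub>presented_group R\<^esub> z)"
    by (simp add: presented_group_mult)
next
  fix x y
  assume "x \<in> carrier (presented_group R)" "y \<in> carrier (presented_group R)"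
  then obtain u v where "x = word_class R u" "y = word_class R v"
    by (auto simp: presented_group_def)
  then show "x \<otimes>\<^bsub>presented_group R\<^esub> y \<in> carrier (presented_group R)"
    by (simp add: presented_group_mult) (simp add: presented_group_def)
next
  show "\<one>\<^bsub>presented_group R\<^esub> \<in> carrier (presented_group R)"
    by (simp add: presented_group_def)
qed


section \<open>The group $C_2^2 \rtimes C_4$\<close>

datatype gen = Gen1 | Gen2 | Gen3

abbreviation "g1 \<equiv> (Gen1, True)"
abbreviation "g2 \<equiv> (Gen2, True)"
abbreviation "g3 \<equiv> (Gen3, True)"

definition C2xC2_C4_relations :: "(gen word \<times> gen word) set" where
  "C2xC2_C4_relations =
     {([g1, g1], []), ([g2, g2], []), ([g3, g3, g3, g3], []),
      ([g1, g2], [g2, g1]), ([g1, g3], [g3, g1]), ([g2, g3], [g3, g2, g1])}"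

definition C2xC2_C4 :: "gen word set monoid" where
  "C2xC2_C4 = presented_group C2xC2_C4_relations"

text \<open>
  The presentation does define a group of order 16: every word has a unique normal form
  \<open>g3\<^sup>c g2\<^sup>b g1\<^sup>a\<close> with \<open>a, b < 2\<close> and \<open>c < 4\<close>.  The function \<open>act\<close> describes left
  multiplication by a letter in terms of the exponents.
\<close>

fun act :: "gen \<times> bool \<Rightarrow> nat \<times> nat \<times> nat \<Rightarrow> nat \<times> nat \<times> nat" where
  "act (Gen1, s) (a, b, c) = ((a + 1) mod 2, b, c)"
| "act (Gen2, s) (a, b, c) = ((a + c) mod 2, (b + 1) mod 2, c)"
| "act (Gen3, s) (a, b, c) = (a, b, (c + (if s then 1 else 3)) mod 4)"

definition exponents :: "(nat \<times> nat \<times> nat) set" where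
  "exponents = {..<2} \<times> {..<2} \<times> {..<4}"

definition exponents_of_word :: "gen word \<Rightarrow> nat \<times> nat \<times> nat" where
  "exponents_of_word w = foldr act w (0, 0, 0)"

fun word_of_exponents :: "nat \<times> nat \<times> nat \<Rightarrow> gen word" where
  "word_of_exponents (a, b, c) = replicate c g3 @ replicate b g2 @ replicate a g1"

lemma exponents_eq:
  "exponents = {(a, b, c) |a b c. a \<in> {0, 1} \<and> b \<in> {0, 1} \<and> c \<in> {0, 1, 2, 3}}"
  by (auto simp: exponents_def)

lemma foldr_act_in: "t \<in> exponents \<Longrightarrow> foldr act w t \<in> exponents"
proof (induction w)
  case (Cons l w)
  then show ?case
    by (cases l; cases "fst l"; cases "foldr act w t") (auto simp: exponents_def)
qed simp

lemma word_cong_imp_foldr_act_eq: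
  assumes "word_cong C2xC2_C4_relations u v" "t \<in> exponents"
  shows "foldr act u t = foldr act v t"
  using assms
proof (induction arbitrary: t rule: word_cong.induct)
  case (rel u v)
  then show ?case
    by (auto simp: C2xC2_C4_relations_def exponents_eq)
next
  case (cancel a s)
  then show ?case
    by (cases a; cases s) (auto simp: exponents_eq)
next
  case (append u u' v v')
  then show ?case
    by (simp add: foldr_act_in)
qed auto

lemma replicate_small:
  "replicate 1 x = [x]" "replicate 2 x = [x, x]" "replicate 3 x = [x, x, x]"
  by (simp_all add: numeral_eq_Suc)

lemma exponents_of_word_of_exponents:
  "t \<in> exponents \<Longrightarrow> exponents_of_word (word_of_exponents t) = t"
  by (auto simp: exponents_eq exponents_of_word_def replicate_small simp del: One_nat_def)

lemma word_cong_letter: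
  assumes "t \<in> exponents"
  shows "word_cong C2xC2_C4_relations (l # word_of_exponents t) (word_of_exponents (act l t))"
proof -
  let ?R = C2xC2_C4_relations
  let ?G = "presented_group ?R"
  interpret group ?G by (rule group_presented_group)
  let ?k = "\<lambda>l. word_class ?R [l]"
  have in_G: "word_class ?R u \<in> carrier ?G" for u
    by (simp add: presented_group_def)
  have one: "word_class ?R [] = \<one>\<^bsub>?G\<^esub>"
    by (simp add: presented_group_def)
  have Cons: "word_class ?R (k # m # u) = ?k k \<otimes>\<^bsub>?G\<^esub> word_class ?R (m # u)" for k m u
    by (simp add: presented_group_mult)
  have r: "word_class ?R u = word_class ?R v" if "(u, v) \<in> ?R" for u v
    using that by (simp add: word_class_eq_iff word_cong.rel)
  have r11: "?k g1 \<otimes>\<^bsub>?G\<^esub> ?k g1 = \<one>\<^bsub>?G\<^esub>" and r22: "?k g2 \<otimes>\<^bsub>?G\<^esub> ?k g2 = \<one>\<^bsub>?G\<^esub>"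
    and r3: "?k g3 \<otimes>\<^bsub>?G\<^esub> (?k g3 \<otimes>\<^bsub>?G\<^esub> (?k g3 \<otimes>\<^bsub>?G\<^esub> ?k g3)) = \<one>\<^bsub>?G\<^esub>"
    and r12: "?k g1 \<otimes>\<^bsub>?G\<^esub> ?k g2 = ?k g2 \<otimes>\<^bsub>?G\<^esub> ?k g1"
    and r13: "?k g1 \<otimes>\<^bsub>?G\<^esub> ?k g3 = ?k g3 \<otimes>\<^bsub>?G\<^esub> ?k g1"
    and r23: "?k g2 \<otimes>\<^bsub>?G\<^esub> ?k g3 = ?k g3 \<otimes>\<^bsub>?G\<^esub> (?k g2 \<otimes>\<^bsub>?G\<^esub> ?k g1)"
    unfolding presented_group_mult one[symmetric] append.simps
    by (rule r, simp add: C2xC2_C4_relations_def)+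
  have c: "?k (a, s) \<otimes>\<^bsub>?G\<^esub> ?k (a, \<not> s) = \<one>\<^bsub>?G\<^esub>" for a s
    unfolding presented_group_mult one[symmetric] word_class_eq_iff
    by (simp add: word_cong.cancel)
  have inverse: "?k (a, False) = y" if "y \<in> carrier ?G" "?k (a, True) \<otimes>\<^bsub>?G\<^esub> y = \<one>\<^bsub>?G\<^esub>" for a y
    using c[of a True] that in_G Units_l_cancel[of "?k (a, True)" "?k (a, False)" y] by simp
  have i1: "?k (Gen1, False) = ?k g1" and i2: "?k (Gen2, False) = ?k g2"
    and i3: "?k (Gen3, False) = ?k g3 \<otimes>\<^bsub>?G\<^esub> (?k g3 \<otimes>\<^bsub>?G\<^esub> ?k g3)"
    using r11 r22 r3 by (auto intro!: inverse in_G m_closed)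
  have r11': "?k g1 \<otimes>\<^bsub>?G\<^esub> (?k g1 \<otimes>\<^bsub>?G\<^esub> z) = z"
    and r22': "?k g2 \<otimes>\<^bsub>?G\<^esub> (?k g2 \<otimes>\<^bsub>?G\<^esub> z) = z"
    and r3': "?k g3 \<otimes>\<^bsub>?G\<^esub> (?k g3 \<otimes>\<^bsub>?G\<^esub> (?k g3 \<otimes>\<^bsub>?G\<^esub> (?k g3 \<otimes>\<^bsub>?G\<^esub> z))) = z"
    and r12': "?k g1 \<otimes>\<^bsub>?G\<^esub> (?k g2 \<otimes>\<^bsub>?G\<^esub> z) = ?k g2 \<otimes>\<^bsub>?G\<^esub> (?k g1 \<otimes>\<^bsub>?G\<^esub> z)"
    and r13': "?k g1 \<otimes>\<^bsub>?G\<^esub> (?k g3 \<otimes>\<^bsub>?G\<^esub> z) = ?k g3 \<otimes>\<^bsub>?G\<^esub> (?k g1 \<otimes>\<^bsub>?G\<^esub> z)"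
    and r23': "?k g2 \<otimes>\<^bsub>?G\<^esub> (?k g3 \<otimes>\<^bsub>?G\<^esub> z) = ?k g3 \<otimes>\<^bsub>?G\<^esub> (?k g2 \<otimes>\<^bsub>?G\<^esub> (?k g1 \<otimes>\<^bsub>?G\<^esub> z))"
    if "z \<in> carrier ?G" for z
    using that in_G
      arg_cong[OF r11, of "\<lambda>x. x \<otimes>\<^bsub>?G\<^esub> z"] arg_cong[OF r22, of "\<lambda>x. x \<otimes>\<^bsub>?G\<^esub> z"]
      arg_cong[OF r3, of "\<lambda>x. x \<otimes>\<^bsub>?G\<^esub> z"] arg_cong[OF r12, of "\<lambda>x. x \<otimes>\<^bsub>?G\<^esub> z"]
      arg_cong[OF r13, of "\<lambda>x. x \<otimes>\<^bsub>?G\<^esub> z"] arg_cong[OF r23, of "\<lambda>x. x \<otimes>\<^bsub>?G\<^esub> z"]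
    by (simp_all add: m_assoc)
  note rules = r11 r22 r3 r12 r13 r23 i1 i2 i3 r11' r22' r3' r12' r13' r23'
  have "word_class ?R (l # word_of_exponents t) = word_class ?R (word_of_exponents (act l t))"
  proof (cases l)
    case (Pair a s)
    show ?thesis
      using assms unfolding Pair exponents_eq
      by (cases a; cases s)
         (auto simp: replicate_small Cons rules one in_G m_assoc simp del: One_nat_def)
  qed
  then show ?thesis
    by (simp add: word_class_eq_iff)
qed

lemma word_cong_normal_form:
  "word_cong C2xC2_C4_relations w (word_of_exponents (exponents_of_word w))"
proof (induction w)
  case Nil
  show ?case by (simp add: exponents_of_word_def word_cong.refl)
next
  case (Cons l w)
  let ?R = C2xC2_C4_relations
  have "word_cong ?R ([l] @ w) ([l] @ word_of_exponents (exponents_of_word w))"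
    by (intro word_cong.append word_cong.refl Cons)
  moreover have "exponents_of_word w \<in> exponents"
    unfolding exponents_of_word_def by (rule foldr_act_in) (simp add: exponents_def)
  from word_cong_letter[OF this, of l]
  have "word_cong ?R ([l] @ word_of_exponents (exponents_of_word w))
      (word_of_exponents (exponents_of_word (l # w)))"
    by (simp add: exponents_of_word_def)
  ultimately show ?case
    using word_cong.trans by fastforce
qed

lemma order_C2xC2_C4: "order C2xC2_C4 = 16"
proof -
  let ?f = "\<lambda>t. word_class C2xC2_C4_relations (word_of_exponents t)"
  have in_E: "exponents_of_word w \<in> exponents" for w
    unfolding exponents_of_word_def by (rule foldr_act_in) (simp add: exponents_def)
  have "word_class C2xC2_C4_relations w = ?f (exponents_of_word w)" for w
    by (simp add: word_class_eq_iff word_cong_normal_form)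
  then have "carrier C2xC2_C4 = ?f ` exponents"
    using in_E by (auto simp: C2xC2_C4_def presented_group_def)
  moreover have "inj_on ?f exponents"
  proof (rule inj_onI)
    fix s t assume st: "s \<in> exponents" "t \<in> exponents" "?f s = ?f t"
    then have "exponents_of_word (word_of_exponents s) = exponents_of_word (word_of_exponents t)"
      unfolding exponents_of_word_def word_class_eq_iff
      by (intro word_cong_imp_foldr_act_eq) (auto simp: exponents_def)
    with st show "s = t" by (simp add: exponents_of_word_of_exponents)
  qed
  ultimately show ?thesis
    by (simp add: Coset.order_def card_image) (simp add: exponents_def)
qed

end

theory Submission
  imports Defs "Jordan_Normal_Form.Determinant" "HOL-Number_Theory.Cong"
begin

text \<open>
  Write \<open>z = g3\<^sup>2\<close>.  The subgroup \<open>V = {1, g1, z, g1 z}\<close> is central and elementary abelian, and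
  \<open>1, g2, g3, g3 g2\<close> represent its cosets.  A character \<open>g1 \<mapsto> s, z \<mapsto> t\<close> of \<open>V\<close>, with
  \<open>s, t = 1, -1\<close>, turns the sixteen variables into four integers \<open>a, b, c, d\<close>: the sums over
  the four cosets twisted by the character.  Since \<open>V\<close> is central, the group matrix becomes
  block diagonal along these four characters over the rationals, so the determinant is the
  product of four \<open>4 \<times> 4\<close> determinants, each that of multiplication by
  \<open>a + b g2 + c g3 + d g3 g2\<close> in the twisted group ring.  For \<open>s = 1\<close> this ring is commutative and the determinant is the product
  of \<open>(a + b)\<^sup>2 - t (c + d)\<^sup>2\<close> and \<open>(a - b)\<^sup>2 - t (c - d)\<^sup>2\<close>.  For \<open>s = -1\<close> the elements \<open>g2\<close> and
  \<open>g3\<close> anticommute, the ring is a quaternion algebra with \<open>g2\<^sup>2 = 1\<close> and \<open>g3\<^sup>2 = t\<close>, and the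
  determinant is the square of the reduced norm \<open>a\<^sup>2 - b\<^sup>2 - t c\<^sup>2 + t d\<^sup>2\<close>.  This factorization is
  \<open>group_det_C2xC2_C4\<close>.

  The parities of \<open>a, b, c, d\<close> are the same for the four characters.  If the sum of all
  variables is even, counting the powers of 2 in the factors gives \<open>2 ^ 14\<close>
  (\<open>norms_dvd_if_even\<close>).

  If the sum is odd, each factor is congruent modulo 16 to the square of the number
  \<open>S = a\<^sup>2 + b\<^sup>2 + c\<^sup>2 + d\<^sup>2\<close> of its character, up to a correction that depends on the parities only;
  the four corrections cancel, and the determinant is congruent to the square of the product of
  the four numbers \<open>S\<close>.  By Parseval the sum of these numbers is four times the sum of the squares of
  the variables, hence 4 modulo 8; as they are odd and congruent to each other modulo 4, their
  product is 1 modulo 8, and its square is 1 modulo 16 (\<open>norms_cong_one_if_odd\<close>).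

  Conversely, adding \<open>m\<close> to all variables changes only the factor of the trivial
  representation, which grows by \<open>16 m\<close>.  The determinants on such lines already fill the set:
  the line through the unit element gives \<open>16 m + 1\<close>, and on four other lines the remaining
  factors have product \<open>2 ^ 12\<close> up to sign, while the factor of the trivial representation runs
  through a residue class of multiples of 4 modulo 16.
\<close>

section \<open>Determinants over finite index sets\<close>

lemma det_on_cong:
  "(\<And>i j. i \<in> I \<Longrightarrow> j \<in> I \<Longrightarrow> M i j = M' i j) \<Longrightarrow> det_on I M = det_on I M'"
  unfolding det_on_def
  by (intro sum.cong prod.cong arg_cong2[of _ _ _ _ "(*)"]) (auto simp: permutes_in_image)

lemma det_on_reindex:
  assumes "bij_betw f J I" "finite J"
  shows "det_on I M = det_on J (\<lambda>i j. M (f i) (f j))"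
proof -
  have inj: "inj_on f J" and I: "I = f ` J"
    using assms(1) by (auto simp: bij_betw_def)
  have "map_permutation J f p = (\<lambda>x. if x \<in> I then f (p (inv_into J f x)) else x)" for p
    by (auto simp: map_permutation_def restrict_id_def I)
  then have bij: "bij_betw (map_permutation J f) {p. p permutes J} {p. p permutes I}"
    using bij_betw_permutations[OF assms(1)] by (simp add: bij_betw_def inj_on_def image_def)
  have "det_on I M = (\<Sum>p | p permutes J. of_int (sign (map_permutation J f p)) *
      (\<Prod>i\<in>I. M i (map_permutation J f p i)))"
    unfolding det_on_def
    by (rule sum.reindex_bij_betw[symmetric]) (rule bij)
  also have "\<dots> = det_on J (\<lambda>i j. M (f i) (f j))"
    unfolding det_on_def
  proof (rule sum.cong)
    fix p assume "p \<in> {p. p permutes J}"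
    moreover have "(\<Prod>i\<in>I. M i (map_permutation J f p i)) = (\<Prod>j\<in>J. M (f j) (f (p j)))"
      unfolding I using inj by (simp add: prod.reindex map_permutation_apply)
    ultimately show "of_int (sign (map_permutation J f p)) *
        (\<Prod>i\<in>I. M i (map_permutation J f p i)) =
        of_int (sign p) * (\<Prod>j\<in>J. M (f j) (f (p j)))"
      using inj assms(2) by (simp add: sign_map_permutation)
  qed simp
  finally show ?thesis .
qed

text \<open>This carries over the block matrix calculus of explicitly sized matrices.\<close>

lemma det_on_lessThan: "det_on {..<n} M = Determinant.det (mat n n (\<lambda>(i, j). M i j))"
proof -
  have "(\<Prod>i<n. M i (p i)) = (\<Prod>i = 0..<n. mat n n (\<lambda>(i, j). M i j) $$ (i, p i))"
    if "p permutes {..<n}" for p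
    unfolding lessThan_atLeast0
    using permutes_in_image[OF that] by (intro prod.cong) (auto simp: index_mat)
  then show ?thesis
    unfolding det_on_def Determinant.det_def
    by (simp add: lessThan_atLeast0)
qed

text \<open>
  The index set consists of two copies of \<open>{..<n}\<close>, exchanged by \<open>i \<mapsto> n + i\<close>.  A matrix that is
  invariant under this exchange of both indices has the blocks \<open>(A B; B A)\<close>, and splits into its
  actions \<open>A + B\<close> and \<open>A - B\<close> on the symmetric and the antisymmetric vectors.
\<close>

lemma det_on_block_circulant:
  fixes M :: "nat \<Rightarrow> nat \<Rightarrow> 'r::idom"
  assumes "\<And>i j. i < n \<Longrightarrow> j < n \<Longrightarrow> M (n + i) (n + j) = M i j"
    and "\<And>i j. i < n \<Longrightarrow> j < n \<Longrightarrow> M (n + i) j = M i (n + j)"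
  shows "det_on {..<n + n} M =
    det_on {..<n} (\<lambda>i j. M i j + M i (n + j)) * det_on {..<n} (\<lambda>i j. M i j - M i (n + j))"
proof -
  let ?A = "mat n n (\<lambda>(i, j). M i j)" and ?B = "mat n n (\<lambda>(i, j). M i (n + j))"
  let ?I = "1\<^sub>m n :: 'r mat" and ?O = "0\<^sub>m n n :: 'r mat"
  let ?M = "four_block_mat ?A ?B ?B ?A"
  have M: "mat (n + n) (n + n) (\<lambda>(i, j). M i j) = ?M"
    using assms by (intro eq_matI) (auto simp: not_less le_iff_add)
  (* Unimodular row and column operations bring the matrix into block triangular form; no
     division by 2 is needed. *)
  let ?L = "four_block_mat ?I ?I ?O ?I" and ?R = "four_block_mat ?I (- ?I) ?O ?I"
  have carrier: "?L \<in> carrier_mat (n + n) (n + n)" "?M \<in> carrier_mat (n + n) (n + n)"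
    "?R \<in> carrier_mat (n + n) (n + n)" by simp_all
  have "?L * ?M * ?R = four_block_mat (?A + ?B) ?O ?B (?A - ?B)"
    by (subst mult_four_block_mat[of _ n n _ n _ n _ _ n _ n], simp_all)+
       (intro arg_cong4[of _ _ _ _ _ _ _ _ four_block_mat] eq_matI; simp)
  moreover have "Determinant.det (?L * ?M * ?R) =
      Determinant.det ?L * Determinant.det ?M * Determinant.det ?R"
    using carrier by (simp only: det_mult[of _ "n + n"] mult_carrier_mat)
  moreover have prod: "Determinant.det (four_block_mat (?A + ?B) ?O ?B (?A - ?B)) =
      Determinant.det (?A + ?B) * Determinant.det (?A - ?B)"
    by (rule det_four_block_mat_upper_right_zero) (auto intro!: minus_carrier_mat)
  ultimately have "Determinant.det ?L * Determinant.det ?M * Determinant.det ?R =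
      Determinant.det (four_block_mat (?A + ?B) ?O ?B (?A - ?B))"
    by simp
  then have "Determinant.det ?M = Determinant.det (?A + ?B) * Determinant.det (?A - ?B)"
    by (simp add: det_four_block_mat_lower_left_zero[of _ n _ n] prod)
  moreover have "?A + ?B = mat n n (\<lambda>(i, j). M i j + M i (n + j))"
    "?A - ?B = mat n n (\<lambda>(i, j). M i j - M i (n + j))"
    by (auto intro: eq_matI)
  ultimately show ?thesis
    by (simp add: det_on_lessThan M)
qed

lemma det_on_4:
  fixes M :: "nat \<Rightarrow> nat \<Rightarrow> 'r::comm_ring_1"
  shows "det_on {..<4} M =
    M 0 0 * (M 1 1 * (M 2 2 * M 3 3 - M 2 3 * M 3 2) - M 1 2 * (M 2 1 * M 3 3 - M 2 3 * M 3 1)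
      + M 1 3 * (M 2 1 * M 3 2 - M 2 2 * M 3 1))
  - M 0 1 * (M 1 0 * (M 2 2 * M 3 3 - M 2 3 * M 3 2) - M 1 2 * (M 2 0 * M 3 3 - M 2 3 * M 3 0)
      + M 1 3 * (M 2 0 * M 3 2 - M 2 2 * M 3 0))
  + M 0 2 * (M 1 0 * (M 2 1 * M 3 3 - M 2 3 * M 3 1) - M 1 1 * (M 2 0 * M 3 3 - M 2 3 * M 3 0)
      + M 1 3 * (M 2 0 * M 3 1 - M 2 1 * M 3 0))
  - M 0 3 * (M 1 0 * (M 2 1 * M 3 2 - M 2 2 * M 3 1) - M 1 1 * (M 2 0 * M 3 2 - M 2 2 * M 3 0)
      + M 1 2 * (M 2 0 * M 3 1 - M 2 1 * M 3 0))"
proof -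
  have "{..<4} = insert (0::nat) (insert 1 (insert 2 (insert 3 {})))" by auto
  moreover have f: "finite {1::nat, 2, 3}" "0 \<notin> {1::nat, 2, 3}"
    "finite {2::nat, 3}" "1 \<notin> {2::nat, 3}" "finite {3::nat}" "2 \<notin> {3::nat}"
    by auto
  ultimately show ?thesis
    unfolding det_on_def
    by (simp only: sum_over_permutations_insert[OF f(1,2)] sum_over_permutations_insert[OF f(3,4)]
          sum_over_permutations_insert[OF f(5,6)] permutes_sing)
      (simp add: sign_swap_id sign_compose permutation_compose permutation_swap_id sign_id
          transpose_def, simp add: algebra_simps)
qed

section \<open>The group in normal form\<close>

text \<open>
  The term \<open>(b + b') c'\<close> is the power of \<open>g1\<close> that arises when a power of \<open>g2\<close> is moved past
  \<open>g3\<close>; adding 4 keeps the subtraction from truncating.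
\<close>

fun exponents_quotient :: "nat \<times> nat \<times> nat \<Rightarrow> nat \<times> nat \<times> nat \<Rightarrow> nat \<times> nat \<times> nat" where
  "exponents_quotient (a, b, c) (a', b', c') =
     ((a + a' + (b + b') * c') mod 2, (b + b') mod 2, (c + 4 - c') mod 4)"

abbreviation elt :: "nat \<times> nat \<times> nat \<Rightarrow> gen word set" where
  "elt t \<equiv> word_class C2xC2_C4_relations (word_of_exponents t)"

lemma exponents_of_word_in: "exponents_of_word w \<in> exponents"
  unfolding exponents_of_word_def by (rule foldr_act_in) (simp add: exponents_def)

lemma word_class_eq_elt: "word_class C2xC2_C4_relations w = elt (exponents_of_word w)"
  by (simp add: word_class_eq_iff word_cong_normal_form)

lemma bij_betw_elt: "bij_betw elt exponents (carrier C2xC2_C4)"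
proof -
  have "carrier C2xC2_C4 = elt ` exponents"
    using word_class_eq_elt exponents_of_word_in by (auto simp: C2xC2_C4_def presented_group_def)
  moreover have "inj_on elt exponents"
  proof (rule inj_onI)
    fix s t assume st: "s \<in> exponents" "t \<in> exponents" "elt s = elt t"
    then have "exponents_of_word (word_of_exponents s) = exponents_of_word (word_of_exponents t)"
      unfolding exponents_of_word_def word_class_eq_iff
      by (intro word_cong_imp_foldr_act_eq) (auto simp: exponents_def)
    with st show "s = t" by (simp add: exponents_of_word_of_exponents)
  qed
  ultimately show ?thesis by (simp add: bij_betw_def)
qed

lemma exponents_of_quotient_append:
  assumes "s \<in> exponents" "t \<in> exponents"
  shows "exponents_of_word (word_of_exponents (exponents_quotient s t) @ word_of_exponents t) = s"
  using assms unfolding exponents_eq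
  by (auto simp: exponents_of_word_def replicate_small simp del: One_nat_def)

lemma elt_exponents_quotient:
  assumes "s \<in> exponents" "t \<in> exponents"
  shows "elt s \<otimes>\<^bsub>C2xC2_C4\<^esub> inv\<^bsub>C2xC2_C4\<^esub> elt t = elt (exponents_quotient s t)"
proof -
  interpret group C2xC2_C4
    unfolding C2xC2_C4_def by (rule group_presented_group)
  have "elt (exponents_quotient s t) \<otimes>\<^bsub>C2xC2_C4\<^esub> elt t = elt s"
    unfolding C2xC2_C4_def presented_group_mult word_class_eq_elt[of "_ @ _"]
    by (simp add: exponents_of_quotient_append assms)
  moreover have "elt u \<in> carrier C2xC2_C4" for u
    by (simp add: C2xC2_C4_def presented_group_def)
  ultimately show ?thesis
    using inv_solve_right by metis
qed

text \<open>
  The index is written in binary, with digits for the exponents of \<open>g1\<close>, \<open>z = g3\<^sup>2\<close>, \<open>g3\<close> and \<open>g2\<close>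
  from the highest to the lowest.  Hence multiplication by \<open>g1\<close> exchanges the two halves of
  \<open>{..<16}\<close>, multiplication by \<open>z\<close> the two halves of \<open>{..<8}\<close>, and the indices below 4 stand for
  \<open>1, g2, g3, g3 g2\<close>.
\<close>

definition exponents_of_index :: "nat \<Rightarrow> nat \<times> nat \<times> nat" where
  "exponents_of_index i = (i div 8, i mod 2, 2 * (i div 4 mod 2) + i div 2 mod 2)"

lemma exponents_of_index_simps:
  "exponents_of_index 0 = (0, 0, 0)" "exponents_of_index 1 = (0, 1, 0)"
  "exponents_of_index 2 = (0, 0, 1)" "exponents_of_index 3 = (0, 1, 1)"
  "exponents_of_index 4 = (0, 0, 2)" "exponents_of_index 5 = (0, 1, 2)"
  "exponents_of_index 6 = (0, 0, 3)" "exponents_of_index 7 = (0, 1, 3)"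
  "exponents_of_index 8 = (1, 0, 0)" "exponents_of_index 9 = (1, 1, 0)"
  "exponents_of_index 10 = (1, 0, 1)" "exponents_of_index 11 = (1, 1, 1)"
  "exponents_of_index 12 = (1, 0, 2)" "exponents_of_index 13 = (1, 1, 2)"
  "exponents_of_index 14 = (1, 0, 3)" "exponents_of_index 15 = (1, 1, 3)"
  by (simp_all add: exponents_of_index_def)

lemma lessThan_4_8_16:
  "{..<4::nat} = {0, 1, 2, 3}"
  "{..<8::nat} = {0, 1, 2, 3, 4, 5, 6, 7}"
  "{..<16::nat} = {0, 1, 2, 3, 4, 5, 6, 7, 8, 9, 10, 11, 12, 13, 14, 15}"
  by (auto simp: lessThan_nat_numeral)

lemma bij_betw_exponents_of_index: "bij_betw exponents_of_index {..<16} exponents"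
proof (rule bij_betw_byWitness[where f' = "\<lambda>(a, b, c). 8 * a + 4 * (c div 2) + 2 * (c mod 2) + b"])
  show "exponents_of_index ` {..<16} \<subseteq> exponents"
    by (auto simp: exponents_of_index_def exponents_def)
qed (auto simp: lessThan_4_8_16 exponents_of_index_def exponents_eq)

lemma group_det_C2xC2_C4_matrix:
  "group_det C2xC2_C4 x = det_on {..<16}
    (\<lambda>i j. x (elt (exponents_quotient (exponents_of_index i) (exponents_of_index j))))"
proof -
  have "finite exponents" by (simp add: exponents_def)
  from det_on_reindex[OF bij_betw_elt this]
  have "group_det C2xC2_C4 x =
      det_on exponents (\<lambda>s t. x (elt s \<otimes>\<^bsub>C2xC2_C4\<^esub> inv\<^bsub>C2xC2_C4\<^esub> elt t))"
    unfolding group_det_def .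
  also have "\<dots> = det_on exponents (\<lambda>s t. x (elt (exponents_quotient s t)))"
    by (rule det_on_cong) (simp only: elt_exponents_quotient)
  also have "\<dots> = det_on {..<16}
      (\<lambda>i j. x (elt (exponents_quotient (exponents_of_index i) (exponents_of_index j))))"
    by (rule det_on_reindex[OF bij_betw_exponents_of_index]) simp
  finally show ?thesis .
qed

section \<open>Factorization of the group determinant\<close>

definition linear_norm :: "int \<Rightarrow> int \<Rightarrow> int \<Rightarrow> int \<Rightarrow> int \<Rightarrow> int" where
  "linear_norm t a b c d = ((a + b)\<^sup>2 - t * (c + d)\<^sup>2) * ((a - b)\<^sup>2 - t * (c - d)\<^sup>2)"

definition reduced_norm :: "int \<Rightarrow> int \<Rightarrow> int \<Rightarrow> int \<Rightarrow> int \<Rightarrow> int" where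
  "reduced_norm t a b c d = a\<^sup>2 - b\<^sup>2 - t * c\<^sup>2 + t * d\<^sup>2"

lemma norm_simps:
  "linear_norm 1 a b c d = ((a + b)\<^sup>2 - (c + d)\<^sup>2) * ((a - b)\<^sup>2 - (c - d)\<^sup>2)"
  "linear_norm (- 1) a b c d = ((a + b)\<^sup>2 + (c + d)\<^sup>2) * ((a - b)\<^sup>2 + (c - d)\<^sup>2)"
  "reduced_norm 1 a b c d = a\<^sup>2 - b\<^sup>2 - c\<^sup>2 + d\<^sup>2"
  "reduced_norm (- 1) a b c d = a\<^sup>2 - b\<^sup>2 + c\<^sup>2 - d\<^sup>2"
  by (simp_all add: linear_norm_def reduced_norm_def)

text \<open>
  The sum of \<open>x\<close> over the coset \<open>g3\<^sup>c g2\<^sup>b V\<close>, twisted by the character \<open>g1 \<mapsto> s, z \<mapsto> t\<close> of \<open>V\<close>.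
\<close>

fun char_sum :: "int \<Rightarrow> int \<Rightarrow> (nat \<times> nat \<times> nat \<Rightarrow> int) \<Rightarrow> nat \<times> nat \<Rightarrow> int" where
  "char_sum s t x (b, c) = x (0, b, c) + s * x (1, b, c) + t * x (0, b, c + 2) + s * t * x (1, b, c + 2)"

abbreviation at_cosets :: "(int \<Rightarrow> int \<Rightarrow> int \<Rightarrow> int \<Rightarrow> 'r) \<Rightarrow> (nat \<times> nat \<Rightarrow> int) \<Rightarrow> 'r" where
  "at_cosets f A \<equiv> f (A (0, 0)) (A (1, 0)) (A (0, 1)) (A (1, 1))"

definition norm_form :: "(nat \<times> nat \<times> nat \<Rightarrow> int) \<Rightarrow> int" where
  "norm_form x =
     at_cosets (linear_norm 1) (char_sum 1 1 x) *
     at_cosets (linear_norm (- 1)) (char_sum 1 (- 1) x) *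
     (at_cosets (reduced_norm 1) (char_sum (- 1) 1 x))\<^sup>2 *
     (at_cosets (reduced_norm (- 1)) (char_sum (- 1) (- 1) x))\<^sup>2"

text \<open>
  The matrix of multiplication by \<open>\<Sum> A (b, c) g3\<^sup>c g2\<^sup>b\<close> in the twisted group ring, where \<open>g1\<close>
  and \<open>z\<close> are the scalars \<open>s\<close> and \<open>t\<close>.
\<close>

definition twisted_entry :: "int \<Rightarrow> int \<Rightarrow> (nat \<times> nat \<Rightarrow> int) \<Rightarrow> nat \<Rightarrow> nat \<Rightarrow> int" where
  "twisted_entry s t A i j =
     (case exponents_quotient (exponents_of_index i) (exponents_of_index j) of (a, b, c) \<Rightarrow>
        s ^ a * t ^ (c div 2) * A (b, c mod 2))"

lemma det_twisted_entry:
  "det_on {..<4} (twisted_entry 1 1 A) = at_cosets (linear_norm 1) A"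
  "det_on {..<4} (twisted_entry 1 (- 1) A) = at_cosets (linear_norm (- 1)) A"
  "det_on {..<4} (twisted_entry (- 1) 1 A) = (at_cosets (reduced_norm 1) A)\<^sup>2"
  "det_on {..<4} (twisted_entry (- 1) (- 1) A) = (at_cosets (reduced_norm (- 1)) A)\<^sup>2"
  unfolding det_on_4 norm_simps
  by (simp_all add: twisted_entry_def exponents_of_index_def power2_eq_square algebra_simps)

theorem group_det_C2xC2_C4:
  fixes x :: "gen word set \<Rightarrow> int"
  shows "group_det C2xC2_C4 x = norm_form (\<lambda>u. x (elt u))"
proof -
  define X where "X u = x (elt u)" for u
  define M where "M i j = X (exponents_quotient (exponents_of_index i) (exponents_of_index j))" for i j
  have shift_g1: "\<forall>i\<in>{..<8}. \<forall>j\<in>{..<8}. M (8 + i) (8 + j) = M i j \<and> M (8 + i) j = M i (8 + j)"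
    unfolding lessThan_4_8_16
    by (simp add: M_def exponents_of_index_simps numeral_2_eq_2[symmetric] del: One_nat_def)
  define half where "half s = det_on {..<8} (\<lambda>i j. M i j + s * M i (8 + j))" for s
  define quarter where "quarter s t =
      det_on {..<4} (\<lambda>i j. M i j + s * M i (8 + j) + t * (M i (4 + j) + s * M i (8 + (4 + j))))"
    for s t
  have "det_on {..<8 + 8} M =
      det_on {..<8} (\<lambda>i j. M i j + M i (8 + j)) * det_on {..<8} (\<lambda>i j. M i j - M i (8 + j))"
    using shift_g1 by (intro det_on_block_circulant) simp_all
  then have split_g1: "det_on {..<16} M = half 1 * half (- 1)"
    by (simp add: half_def)
  have shift_z: "\<forall>i\<in>{..<4}. \<forall>j\<in>{..<4}. M (4 + i) (4 + j) = M i j \<and> M (4 + i) j = M i (4 + j)"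
    and shift_g1_z: "\<forall>i\<in>{..<4}. \<forall>j\<in>{..<4}.
      M (4 + i) (8 + (4 + j)) = M i (8 + j) \<and> M (4 + i) (8 + j) = M i (8 + (4 + j))"
    unfolding lessThan_4_8_16
    by (simp_all add: M_def exponents_of_index_simps numeral_2_eq_2[symmetric] del: One_nat_def)
  have "det_on {..<4 + 4} (\<lambda>i j. M i j + s * M i (8 + j)) =
      det_on {..<4} (\<lambda>i j. M i j + s * M i (8 + j) + (M i (4 + j) + s * M i (8 + (4 + j)))) *
      det_on {..<4} (\<lambda>i j. M i j + s * M i (8 + j) - (M i (4 + j) + s * M i (8 + (4 + j))))" for s
    using shift_z shift_g1_z by (intro det_on_block_circulant) simp_all
  then have split_z: "half s = quarter s 1 * quarter s (- 1)" for s
    by (simp add: half_def quarter_def algebra_simps)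
  have entries: "quarter s t = det_on {..<4} (twisted_entry s t (char_sum s t X))"
    if "s = 1 \<or> s = - 1" "t = 1 \<or> t = - 1" for s t
    unfolding quarter_def
  proof (rule det_on_cong)
    have "\<forall>i\<in>{..<4}. \<forall>j\<in>{..<4}.
        M i j + s * M i (8 + j) + t * (M i (4 + j) + s * M i (8 + (4 + j))) =
        twisted_entry s t (char_sum s t X) i j"
      unfolding lessThan_4_8_16 using that
      by (elim disjE) (simp_all add: M_def twisted_entry_def exponents_of_index_simps
        numeral_2_eq_2[symmetric] del: One_nat_def)
    then show "M i j + s * M i (8 + j) + t * (M i (4 + j) + s * M i (8 + (4 + j))) =
        twisted_entry s t (char_sum s t X) i j" if "i \<in> {..<4}" "j \<in> {..<4}" for i j
      using that by blast
  qed
  have "group_det C2xC2_C4 x = det_on {..<16} M"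
    by (simp add: group_det_C2xC2_C4_matrix M_def[abs_def] X_def)
  also have "\<dots> = norm_form X"
    by (simp only: split_g1 split_z entries det_twisted_entry norm_form_def mult.assoc simp_thms)
  finally show ?thesis by (simp add: X_def[abs_def])
qed

lemma norm_form_cong: "(\<And>u. u \<in> exponents \<Longrightarrow> x u = y u) \<Longrightarrow> norm_form x = norm_form y"
  by (simp add: norm_form_def exponents_def)

theorem integer_group_dets_C2xC2_C4: "integer_group_dets C2xC2_C4 = range norm_form"
proof -
  have "\<exists>x. group_det C2xC2_C4 x = norm_form y" for y
  proof (intro exI)
    have "norm_form (\<lambda>u. y (inv_into exponents elt (elt u))) = norm_form y"
      by (intro norm_form_cong) (simp only: inv_into_f_f[OF bij_betw_imp_inj_on[OF bij_betw_elt]])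
    then show "group_det C2xC2_C4 (\<lambda>w. y (inv_into exponents elt w)) = norm_form y"
      by (simp add: group_det_C2xC2_C4)
  qed
  then have "range norm_form \<subseteq> integer_group_dets C2xC2_C4"
    unfolding integer_group_dets_def by (auto simp: eq_commute)
  moreover have "integer_group_dets C2xC2_C4 \<subseteq> range norm_form"
    unfolding integer_group_dets_def by (auto simp: group_det_C2xC2_C4)
  ultimately show ?thesis by blast
qed

section \<open>Values at points with even sum\<close>

lemma four_dvd_diff_squares: "even (a - b) \<Longrightarrow> 4 dvd a\<^sup>2 - (b::int)\<^sup>2"
proof -
  assume "even (a - b)"
  then have "2 * 2 dvd (a - b) * (a + b)" by (intro mult_dvd_mono) auto
  then show ?thesis by (simp add: power2_eq_square algebra_simps)
qed

lemma four_dvd_sum_squares: "even a \<Longrightarrow> even b \<Longrightarrow> 4 dvd a\<^sup>2 + (b::int)\<^sup>2"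
  by (auto elim!: evenE simp: power_mult_distrib)

lemma odd_squareE:
  fixes a :: int
  assumes "odd a"
  obtains k where "a\<^sup>2 = 8 * k + 1"
proof -
  obtain m where m: "a = 2 * m + 1" using assms by (elim oddE)
  have "even (m * (m + 1))" by simp
  then obtain k where "m * (m + 1) = 2 * k" by (elim evenE)
  then have "a\<^sup>2 = 8 * k + 1" by (simp add: m power2_eq_square algebra_simps)
  then show ?thesis by (rule that)
qed

lemma odd_square_mod_8: "odd a \<Longrightarrow> a\<^sup>2 mod 8 = (1::int)"
  by (auto elim: odd_squareE)

lemma eight_dvd_diff_odd_squares: "odd a \<Longrightarrow> odd b \<Longrightarrow> 8 dvd a\<^sup>2 - (b::int)\<^sup>2"
  by (simp add: odd_square_mod_8 mod_eq_dvd_iff[symmetric])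

text \<open>
  If \<open>a\<close> and \<open>b\<close> have the same parity, so have \<open>c\<close> and \<open>d\<close>, and the linear norms and the
  squares of the reduced norms contribute \<open>2 ^ 4\<close> each.  Otherwise \<open>a \<plusminus> b\<close> and \<open>c \<plusminus> d\<close> are
  odd, so that the two linear norms contribute \<open>2 ^ 6\<close> and \<open>2 ^ 2\<close>.  In this case \<open>a\<close> has the parity of either \<open>c\<close> or \<open>d\<close>, which
  makes one of the reduced norms divisible by 4, the other one being even; their squares supply
  the missing \<open>2 ^ 6\<close>.
\<close>

lemma norms_dvd_if_even:
  assumes par: "even a2 = even a1" "even a3 = even a1" "even a4 = even a1"
    "even b2 = even b1" "even b3 = even b1" "even b4 = even b1"
    "even c2 = even c1" "even c3 = even c1" "even c4 = even c1"
    "even d2 = even d1" "even d3 = even d1" "even d4 = even d1"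
    and even: "even (a1 + b1 + c1 + d1)"
  shows "2 ^ 14 dvd linear_norm 1 a1 b1 c1 d1 * linear_norm (- 1) a2 b2 c2 d2 *
    (reduced_norm 1 a3 b3 c3 d3)\<^sup>2 * (reduced_norm (- 1) a4 b4 c4 d4)\<^sup>2"
proof (cases "even (a1 - b1)")
  case True
  have "4 * 4 dvd linear_norm 1 a1 b1 c1 d1" unfolding norm_simps
    using True even by (intro mult_dvd_mono four_dvd_diff_squares) (auto simp: par)
  moreover have "4 * 4 dvd linear_norm (- 1) a2 b2 c2 d2" unfolding norm_simps
    using True even by (intro mult_dvd_mono four_dvd_sum_squares) (auto simp: par)
  moreover have "4 dvd (a3\<^sup>2 - b3\<^sup>2) - (c3\<^sup>2 - d3\<^sup>2)"
    using True even
    by (intro dvd_diff[OF four_dvd_diff_squares four_dvd_diff_squares]) (auto simp: par)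
  then have "4\<^sup>2 dvd (reduced_norm 1 a3 b3 c3 d3)\<^sup>2"
    by (intro dvd_power_same) (simp add: norm_simps algebra_simps)
  moreover have "4 dvd (a4\<^sup>2 - b4\<^sup>2) + (c4\<^sup>2 - d4\<^sup>2)"
    using True even
    by (intro dvd_add[OF four_dvd_diff_squares four_dvd_diff_squares]) (auto simp: par)
  then have "4\<^sup>2 dvd (reduced_norm (- 1) a4 b4 c4 d4)\<^sup>2"
    by (intro dvd_power_same) (simp add: norm_simps algebra_simps)
  ultimately have "(4 * 4) * (4 * 4) * 4\<^sup>2 * 4\<^sup>2 dvd
      linear_norm 1 a1 b1 c1 d1 * linear_norm (- 1) a2 b2 c2 d2 *
      (reduced_norm 1 a3 b3 c3 d3)\<^sup>2 * (reduced_norm (- 1) a4 b4 c4 d4)\<^sup>2"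
    by (intro mult_dvd_mono)
  then show ?thesis by (rule dvd_trans[rotated]) simp
next
  case False
  have "8 * 8 dvd linear_norm 1 a1 b1 c1 d1" unfolding norm_simps
    using False even by (intro mult_dvd_mono eight_dvd_diff_odd_squares) (auto simp: par)
  moreover have "2 * 2 dvd linear_norm (- 1) a2 b2 c2 d2" unfolding norm_simps
    using False even by (intro mult_dvd_mono) (auto simp: par)
  moreover have "4 * 2 dvd reduced_norm 1 a3 b3 c3 d3 * reduced_norm (- 1) a4 b4 c4 d4"
  proof (cases "even (a1 - c1)")
    case True
    have "4 dvd (a3\<^sup>2 - c3\<^sup>2) - (b3\<^sup>2 - d3\<^sup>2)"
      using True False even
      by (intro dvd_diff[OF four_dvd_diff_squares four_dvd_diff_squares]) (auto simp: par)
    moreover have "even (a4 + b4 + c4 + d4)"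
      using even by (simp add: par)
    ultimately show ?thesis
      by (intro mult_dvd_mono) (auto simp: norm_simps algebra_simps)
  next
    case c: False
    have "4 dvd (a4\<^sup>2 - d4\<^sup>2) - (b4\<^sup>2 - c4\<^sup>2)"
      using c False even
      by (intro dvd_diff[OF four_dvd_diff_squares four_dvd_diff_squares]) (auto simp: par)
    moreover have "even (a3 + b3 + c3 + d3)"
      using even by (simp add: par)
    ultimately have "2 * 4 dvd reduced_norm 1 a3 b3 c3 d3 * reduced_norm (- 1) a4 b4 c4 d4"
      by (intro mult_dvd_mono) (auto simp: norm_simps algebra_simps)
    then show ?thesis by simp
  qed
  then have "(4 * 2)\<^sup>2 dvd (reduced_norm 1 a3 b3 c3 d3 * reduced_norm (- 1) a4 b4 c4 d4)\<^sup>2"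
    by (rule dvd_power_same)
  ultimately have "(8 * 8) * (2 * 2) * (4 * 2)\<^sup>2 dvd
      linear_norm 1 a1 b1 c1 d1 * linear_norm (- 1) a2 b2 c2 d2 *
      (reduced_norm 1 a3 b3 c3 d3 * reduced_norm (- 1) a4 b4 c4 d4)\<^sup>2"
    by (intro mult_dvd_mono)
  then show ?thesis by (simp add: power_mult_distrib mult.assoc)
qed

section \<open>Values at points with odd sum\<close>

definition sum_of_squares :: "int \<Rightarrow> int \<Rightarrow> int \<Rightarrow> int \<Rightarrow> int" where
  "sum_of_squares a b c d = a\<^sup>2 + b\<^sup>2 + c\<^sup>2 + d\<^sup>2"

lemma square_mod_4: "a\<^sup>2 mod 4 = (a::int) mod 2"
proof (cases "even a")
  case True
  then show ?thesis by (auto elim!: evenE simp: power_mult_distrib)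
next
  case False
  have "a\<^sup>2 mod 4 = a\<^sup>2 mod 8 mod 4" by (simp add: mod_mod_cancel)
  then show ?thesis using False by (simp add: odd_square_mod_8 odd_iff_mod_2_eq_one)
qed

definition three_odd :: "int \<Rightarrow> int \<Rightarrow> int \<Rightarrow> int \<Rightarrow> int" where
  "three_odd a b c d = (if a mod 2 + b mod 2 + c mod 2 + d mod 2 = 3 then 1 else 0)"

lemma cong_16I:
  fixes F :: int
  assumes "F = S - 4 * K" "[K = r] (mod 4)"
  shows "[F = S - 4 * r] (mod (16::int))"
proof -
  obtain k where "K - r = 4 * k"
    using assms(2) unfolding cong_iff_dvd_diff by (elim dvdE)
  then have "K = r + 4 * k" by simp
  then have "F = S - 4 * r + 16 * (- k)" using assms(1) by simp
  then show ?thesis by (simp only: cong_def mod_mult_self2)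
qed

text \<open>
  Each left hand side is \<open>S\<^sup>2 - 4 K\<close> where \<open>S\<close> is the sum of squares and \<open>K\<close> is a form in the
  squares, apart from a term \<open>2 a b c d\<close> up to sign for the linear norms, which is a multiple of 4
  because one of the numbers is even.  As a
  square is congruent modulo 4 to its parity, \<open>K\<close> can be evaluated on parities.  Among four
  numbers with odd sum either one or three are odd, and \<open>K\<close> vanishes in the first case.
\<close>

lemma
  assumes "odd (a + b + c + d)"
  shows linear_norm_pos_mod_16: "[linear_norm 1 a b c d =
      (sum_of_squares a b c d)\<^sup>2 - 4 * (3 * three_odd a b c d)] (mod 16)"
    and linear_norm_neg_mod_16: "[linear_norm (- 1) a b c d =
      (sum_of_squares a b c d)\<^sup>2 - 4 * three_odd a b c d] (mod 16)"
    and reduced_norm_pos_mod_16: "[(reduced_norm 1 a b c d)\<^sup>2 =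
      (sum_of_squares a b c d)\<^sup>2 - 4 * (2 * three_odd a b c d)] (mod 16)"
    and reduced_norm_neg_mod_16: "[(reduced_norm (- 1) a b c d)\<^sup>2 =
      (sum_of_squares a b c d)\<^sup>2 - 4 * (2 * three_odd a b c d)] (mod 16)"
proof -
  have m: "a mod 2 = 0 \<or> a mod 2 = 1" "b mod 2 = 0 \<or> b mod 2 = 1"
     "c mod 2 = 0 \<or> c mod 2 = 1" "d mod 2 = 0 \<or> d mod 2 = 1" by auto
  have "even (a * b * c * d)" using assms by auto
  then have z: "[2 * (a * b * c * d) = 0] (mod 4)" "[2 * (- (a * b * c * d)) = 0] (mod 4)"
    by (auto elim!: evenE simp: cong_def)
  have r: "[x\<^sup>2 = x mod 2] (mod 4)" for x :: int
    by (simp add: cong_def flip: square_mod_4)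
  have odd: "(a mod 2 + b mod 2 + c mod 2 + d mod 2) mod 2 = 1"
    using assms by presburger
  have K1: "[(a\<^sup>2 + b\<^sup>2) * (c\<^sup>2 + d\<^sup>2) + a\<^sup>2 * b\<^sup>2 + c\<^sup>2 * d\<^sup>2 + 2 * (- (a * b * c * d))
      = 3 * three_odd a b c d] (mod 4)"
  proof -
    have "[(a\<^sup>2 + b\<^sup>2) * (c\<^sup>2 + d\<^sup>2) + a\<^sup>2 * b\<^sup>2 + c\<^sup>2 * d\<^sup>2 + 2 * (- (a * b * c * d))
        = (a mod 2 + b mod 2) * (c mod 2 + d mod 2) +
          a mod 2 * (b mod 2) + c mod 2 * (d mod 2) + 0] (mod 4)"
      by (intro cong_add cong_mult r z)
    also have "(a mod 2 + b mod 2) * (c mod 2 + d mod 2) +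
          a mod 2 * (b mod 2) + c mod 2 * (d mod 2) + 0 = 3 * three_odd a b c d"
      using m odd unfolding three_odd_def by (elim disjE) simp_all
    finally show ?thesis .
  qed
  have K2: "[a\<^sup>2 * b\<^sup>2 + c\<^sup>2 * d\<^sup>2 + 2 * (a * b * c * d)
      = three_odd a b c d] (mod 4)"
  proof -
    have "[a\<^sup>2 * b\<^sup>2 + c\<^sup>2 * d\<^sup>2 + 2 * (a * b * c * d)
        = a mod 2 * (b mod 2) + c mod 2 * (d mod 2) + 0] (mod 4)"
      by (intro cong_add cong_mult r z)
    also have "a mod 2 * (b mod 2) + c mod 2 * (d mod 2) + 0 = three_odd a b c d"
      using m odd unfolding three_odd_def by (elim disjE) simp_all
    finally show ?thesis .
  qed
  have K3: "[(a\<^sup>2 + d\<^sup>2) * (b\<^sup>2 + c\<^sup>2)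
      = 2 * three_odd a b c d] (mod 4)"
  proof -
    have "[(a\<^sup>2 + d\<^sup>2) * (b\<^sup>2 + c\<^sup>2)
        = (a mod 2 + d mod 2) * (b mod 2 + c mod 2)] (mod 4)"
      by (intro cong_add cong_mult r)
    also have "(a mod 2 + d mod 2) * (b mod 2 + c mod 2) = 2 * three_odd a b c d"
      using m odd unfolding three_odd_def by (elim disjE) simp_all
    finally show ?thesis .
  qed
  have K4: "[(a\<^sup>2 + c\<^sup>2) * (b\<^sup>2 + d\<^sup>2)
      = 2 * three_odd a b c d] (mod 4)"
  proof -
    have "[(a\<^sup>2 + c\<^sup>2) * (b\<^sup>2 + d\<^sup>2)
        = (a mod 2 + c mod 2) * (b mod 2 + d mod 2)] (mod 4)"
      by (intro cong_add cong_mult r)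
    also have "(a mod 2 + c mod 2) * (b mod 2 + d mod 2) = 2 * three_odd a b c d"
      using m odd unfolding three_odd_def by (elim disjE) simp_all
    finally show ?thesis .
  qed
  show "[linear_norm 1 a b c d =
      (sum_of_squares a b c d)\<^sup>2 - 4 * (3 * three_odd a b c d)] (mod 16)"
    by (rule cong_16I[OF _ K1]) (simp add: norm_simps sum_of_squares_def power2_eq_square algebra_simps)
  show "[linear_norm (- 1) a b c d =
      (sum_of_squares a b c d)\<^sup>2 - 4 * three_odd a b c d] (mod 16)"
    by (rule cong_16I[OF _ K2]) (simp add: norm_simps sum_of_squares_def power2_eq_square algebra_simps)
  show "[(reduced_norm 1 a b c d)\<^sup>2 =
      (sum_of_squares a b c d)\<^sup>2 - 4 * (2 * three_odd a b c d)] (mod 16)"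
    by (rule cong_16I[OF _ K3]) (simp add: norm_simps sum_of_squares_def power2_eq_square algebra_simps)
  show "[(reduced_norm (- 1) a b c d)\<^sup>2 =
      (sum_of_squares a b c d)\<^sup>2 - 4 * (2 * three_odd a b c d)] (mod 16)"
    by (rule cong_16I[OF _ K4]) (simp add: norm_simps sum_of_squares_def power2_eq_square algebra_simps)
qed

text \<open>
  Writing the numbers as \<open>s + 4 m\<close> with \<open>s\<close> the first of them, the condition on the sum says that
  the sum of the \<open>m\<close> is even, and the product is \<open>s ^ 4 + 4 s ^ 3 \<Sum>m\<close> modulo 8.
\<close>

lemma product_mod_8:
  fixes s1 s2 s3 s4 :: int
  assumes "odd s1" "4 dvd s2 - s1" "4 dvd s3 - s1" "4 dvd s4 - s1"
    and "(s1 + s2 + s3 + s4) mod 8 = 4"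
  shows "[s1 * s2 * s3 * s4 = 1] (mod 8)"
proof -
  obtain i j k where "s2 - s1 = 4 * i" "s3 - s1 = 4 * j" "s4 - s1 = 4 * k"
    using assms(2-4) by (elim dvdE)
  then have s: "s2 = s1 + 4 * i" "s3 = s1 + 4 * j" "s4 = s1 + 4 * k" by simp_all
  have "even (i + j + k)" using assms(1,5) unfolding s by presburger
  then obtain n where n: "i + j + k = 2 * n" by (elim evenE)
  obtain u where u: "s1\<^sup>2 = 8 * u + 1"
    using odd_squareE[OF assms(1)] .
  have "s1 * s2 * s3 * s4 = (s1\<^sup>2)\<^sup>2 + 4 * s1 ^ 3 * (i + j + k) +
      16 * (s1\<^sup>2 * (i * j + i * k + j * k) + 4 * s1 * i * j * k)"
    unfolding s by (simp add: algebra_simps power2_eq_square power3_eq_cube)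
  moreover note n
  moreover have "(8 * u + 1)\<^sup>2 = 1 + 16 * (4 * u\<^sup>2 + u)"
    by (simp add: algebra_simps power2_eq_square)
  ultimately have "s1 * s2 * s3 * s4 = 1 + 8 * (2 * (4 * u\<^sup>2 + u) + s1 ^ 3 * n +
      2 * (s1\<^sup>2 * (i * j + i * k + j * k) + 4 * s1 * i * j * k))"
    unfolding u by (simp only:) (simp add: algebra_simps)
  then show ?thesis by (simp only: cong_def mod_mult_self2)
qed

text \<open>
  The corrections cancel because odd squares are 1 modulo 8: the first two contribute
  \<open>- 4 e (s1\<^sup>2 + 3 s2\<^sup>2) + 48 e\<^sup>2\<close> and the last two \<open>- 8 e (s3\<^sup>2 + s4\<^sup>2) + 64 e\<^sup>2\<close>.
\<close>

lemma corrected_squares_cong_one: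
  fixes s1 s2 s3 s4 e :: int
  assumes "odd s1" "odd s2" "odd s3" "odd s4" "[s1 * s2 * s3 * s4 = 1] (mod 8)"
  shows "[(s1\<^sup>2 - 4 * (3 * e)) * (s2\<^sup>2 - 4 * e) *
    (s3\<^sup>2 - 4 * (2 * e)) * (s4\<^sup>2 - 4 * (2 * e)) = 1] (mod 16)"
proof -
  obtain u1 u2 u3 u4 where u: "s1\<^sup>2 = 8 * u1 + 1" "s2\<^sup>2 = 8 * u2 + 1"
      "s3\<^sup>2 = 8 * u3 + 1" "s4\<^sup>2 = 8 * u4 + 1"
    using assms(1-4) by (elim odd_squareE)
  obtain p where "s1 * s2 * s3 * s4 - 1 = 8 * p"
    using assms(5) unfolding cong_iff_dvd_diff by (elim dvdE)
  then have p: "s1 * s2 * s3 * s4 = 8 * p + 1" by simp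
  have "[(s1\<^sup>2 - 4 * (3 * e)) * (s2\<^sup>2 - 4 * e) = s1\<^sup>2 * s2\<^sup>2] (mod 16)"
  proof -
    have "(s1\<^sup>2 - 4 * (3 * e)) * (s2\<^sup>2 - 4 * e) =
        s1\<^sup>2 * s2\<^sup>2 + 16 * (- e - 2 * e * u1 - 6 * e * u2 + 3 * e\<^sup>2)"
      unfolding u by (simp add: algebra_simps power2_eq_square power3_eq_cube)
    then show ?thesis by (simp only: cong_def mod_mult_self2)
  qed
  moreover have "[(s3\<^sup>2 - 4 * (2 * e)) * (s4\<^sup>2 - 4 * (2 * e)) = s3\<^sup>2 * s4\<^sup>2] (mod 16)"
  proof -
    have "(s3\<^sup>2 - 4 * (2 * e)) * (s4\<^sup>2 - 4 * (2 * e)) =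
        s3\<^sup>2 * s4\<^sup>2 + 16 * (- e - 4 * e * u3 - 4 * e * u4 + 4 * e\<^sup>2)"
      unfolding u by (simp add: algebra_simps power2_eq_square power3_eq_cube)
    then show ?thesis by (simp only: cong_def mod_mult_self2)
  qed
  ultimately have "[(s1\<^sup>2 - 4 * (3 * e)) * (s2\<^sup>2 - 4 * e) * ((s3\<^sup>2 - 4 * (2 * e)) * (s4\<^sup>2 - 4 * (2 * e)))
      = s1\<^sup>2 * s2\<^sup>2 * (s3\<^sup>2 * s4\<^sup>2)] (mod 16)"
    by (rule cong_mult)
  moreover have "s1\<^sup>2 * s2\<^sup>2 * (s3\<^sup>2 * s4\<^sup>2) = (s1 * s2 * s3 * s4)\<^sup>2"
    by (simp add: algebra_simps power2_eq_square power3_eq_cube)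
  moreover have "(8 * p + 1)\<^sup>2 = 1 + 16 * (4 * p\<^sup>2 + p)"
    by (simp add: algebra_simps power2_eq_square power3_eq_cube)
  ultimately show ?thesis unfolding p by (simp only: cong_def mod_mult_self2 mult.assoc)
qed

lemma norms_cong_one_if_odd:
  assumes par: "even a2 = even a1" "even a3 = even a1" "even a4 = even a1"
    "even b2 = even b1" "even b3 = even b1" "even b4 = even b1"
    "even c2 = even c1" "even c3 = even c1" "even c4 = even c1"
    "even d2 = even d1" "even d3 = even d1" "even d4 = even d1"
    and odd: "odd (a1 + b1 + c1 + d1)"
    and parseval: "sum_of_squares a1 b1 c1 d1 + sum_of_squares a2 b2 c2 d2 +
      sum_of_squares a3 b3 c3 d3 + sum_of_squares a4 b4 c4 d4 = 4 * q" "odd q"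
  shows "[linear_norm 1 a1 b1 c1 d1 * linear_norm (- 1) a2 b2 c2 d2 *
    (reduced_norm 1 a3 b3 c3 d3)\<^sup>2 * (reduced_norm (- 1) a4 b4 c4 d4)\<^sup>2 = 1] (mod 16)"
proof -
  let ?e = "three_odd a1 b1 c1 d1"
  define s1 s2 s3 s4 where s_defs: "s1 = sum_of_squares a1 b1 c1 d1" "s2 = sum_of_squares a2 b2 c2 d2"
    "s3 = sum_of_squares a3 b3 c3 d3" "s4 = sum_of_squares a4 b4 c4 d4"
  have e: "three_odd a2 b2 c2 d2 = ?e" "three_odd a3 b3 c3 d3 = ?e" "three_odd a4 b4 c4 d4 = ?e"
    by (simp_all add: three_odd_def mod_2_eq_odd par)
  have odd_sums: "odd (a2 + b2 + c2 + d2)" "odd (a3 + b3 + c3 + d3)" "odd (a4 + b4 + c4 + d4)"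
    using odd by (simp_all add: par)
  have odd_s: "odd s1" "odd s2" "odd s3" "odd s4"
    using odd by (simp_all add: s_defs sum_of_squares_def par)
  have cong: "4 dvd sum_of_squares a b c d - s1"
    if "even a = even a1" "even b = even b1" "even c = even c1" "even d = even d1" for a b c d
  proof -
    have "4 dvd (a\<^sup>2 - a1\<^sup>2) + (b\<^sup>2 - b1\<^sup>2) + (c\<^sup>2 - c1\<^sup>2) + (d\<^sup>2 - d1\<^sup>2)"
      using that by (intro dvd_add[OF dvd_add[OF dvd_add]] four_dvd_diff_squares) simp_all
    then show ?thesis by (simp add: s_defs sum_of_squares_def algebra_simps)
  qed
  have sum: "(s1 + s2 + s3 + s4) mod 8 = 4"
    using parseval unfolding s_defs[symmetric] by presburger
  have "[s1 * s2 * s3 * s4 = 1] (mod 8)"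
    using odd_s(1) sum by (intro product_mod_8) (simp_all add: s_defs(2-4) cong par)
  then have "[(s1\<^sup>2 - 4 * (3 * ?e)) * (s2\<^sup>2 - 4 * ?e) * (s3\<^sup>2 - 4 * (2 * ?e)) * (s4\<^sup>2 - 4 * (2 * ?e)) = 1]
      (mod 16)"
    by (rule corrected_squares_cong_one[OF odd_s])
  moreover have "[linear_norm 1 a1 b1 c1 d1 * linear_norm (- 1) a2 b2 c2 d2 *
      (reduced_norm 1 a3 b3 c3 d3)\<^sup>2 * (reduced_norm (- 1) a4 b4 c4 d4)\<^sup>2 =
      (s1\<^sup>2 - 4 * (3 * ?e)) * (s2\<^sup>2 - 4 * ?e) * (s3\<^sup>2 - 4 * (2 * ?e)) * (s4\<^sup>2 - 4 * (2 * ?e))] (mod 16)"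
    using linear_norm_pos_mod_16[OF odd] linear_norm_neg_mod_16[OF odd_sums(1)]
      reduced_norm_pos_mod_16[OF odd_sums(2)] reduced_norm_neg_mod_16[OF odd_sums(3)]
    unfolding s_defs e by (intro cong_mult)
  ultimately show ?thesis by (rule cong_trans[rotated])
qed

section \<open>The set of values\<close>

lemma even_char_sum:
  "even (char_sum 1 (- 1) x p) = even (char_sum 1 1 x p)"
  "even (char_sum (- 1) 1 x p) = even (char_sum 1 1 x p)"
  "even (char_sum (- 1) (- 1) x p) = even (char_sum 1 1 x p)"
  by (cases p; simp)+

lemma parseval_char_sum:
  "(char_sum 1 1 x (b, c))\<^sup>2 + (char_sum 1 (- 1) x (b, c))\<^sup>2 +
   (char_sum (- 1) 1 x (b, c))\<^sup>2 + (char_sum (- 1) (- 1) x (b, c))\<^sup>2 =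
   4 * ((x (0, b, c))\<^sup>2 + (x (1, b, c))\<^sup>2 + (x (0, b, c + 2))\<^sup>2 + (x (1, b, c + 2))\<^sup>2)"
  by (simp add: power2_eq_square algebra_simps)

lemma norm_form_in:
  "norm_form x \<in> {16 * m + 1 |m. True} \<union> {2 ^ 14 * k |k. True}"
proof (cases "even (at_cosets (\<lambda>a b c d. a + b + c + d) (char_sum 1 1 x))")
  case True
  then have "2 ^ 14 dvd norm_form x"
    unfolding norm_form_def by (intro norms_dvd_if_even even_char_sum)
  then show ?thesis by (auto elim: dvdE)
next
  case False
  define r where "r b c = (x (0, b, c))\<^sup>2 + (x (1, b, c))\<^sup>2 + (x (0, b, c + 2))\<^sup>2 + (x (1, b, c + 2))\<^sup>2"
    for b c
  have "[norm_form x = 1] (mod 16)"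
    unfolding norm_form_def
  proof (intro norms_cong_one_if_odd even_char_sum)
    show "odd (char_sum 1 1 x (0, 0) + char_sum 1 1 x (1, 0) + char_sum 1 1 x (0, 1) + char_sum 1 1 x (1, 1))"
      using False .
    show "at_cosets sum_of_squares (char_sum 1 1 x) + at_cosets sum_of_squares (char_sum 1 (- 1) x) +
        at_cosets sum_of_squares (char_sum (- 1) 1 x) + at_cosets sum_of_squares (char_sum (- 1) (- 1) x) =
        4 * (r 0 0 + r 1 0 + r 0 1 + r 1 1)"
      using parseval_char_sum[of x 0 0] parseval_char_sum[of x 1 0]
        parseval_char_sum[of x 0 1] parseval_char_sum[of x 1 1]
      unfolding sum_of_squares_def r_def[symmetric] by (simp only: distrib_left)
    show "odd (r 0 0 + r 1 0 + r 0 1 + r 1 1)"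
      using False by (simp add: r_def)
  qed
  then have "16 dvd norm_form x - 1"
    unfolding cong_iff_dvd_diff .
  then obtain m where "norm_form x - 1 = 16 * m" by (elim dvdE)
  then have "norm_form x = 16 * m + 1" by simp
  then show ?thesis by blast
qed

text \<open>The product of the factors that belong to the nontrivial irreducible representations.\<close>

definition cofactor :: "(nat \<times> nat \<times> nat \<Rightarrow> int) \<Rightarrow> int" where
  "cofactor x =
     at_cosets (\<lambda>a b c d. (a + b - c - d) * (a - b + c - d) * (a - b - c + d)) (char_sum 1 1 x) *
     at_cosets (linear_norm (- 1)) (char_sum 1 (- 1) x) *
     (at_cosets (reduced_norm 1) (char_sum (- 1) 1 x))\<^sup>2 *
     (at_cosets (reduced_norm (- 1)) (char_sum (- 1) (- 1) x))\<^sup>2"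

definition coefficient_sum :: "(nat \<times> nat \<times> nat \<Rightarrow> int) \<Rightarrow> int" where
  "coefficient_sum x = at_cosets (\<lambda>a b c d. a + b + c + d) (char_sum 1 1 x)"

lemma linear_norm_add_const:
  "linear_norm 1 (4 * m + a) (4 * m + b) (4 * m + c) (4 * m + d) =
     (16 * m + (a + b + c + d)) * ((a + b - c - d) * (a - b + c - d) * (a - b - c + d))"
  by (simp add: norm_simps power2_eq_square algebra_simps)

text \<open>
  The factor \<open>a + b + c + d\<close> of the trivial representation sees the constant \<open>m\<close> sixteen times;
  every other irreducible representation annihilates constant functions.
\<close>

lemma norm_form_add_const:
  "norm_form (\<lambda>u. m + x u) = (16 * m + coefficient_sum x) * cofactor x"
proof -
  have "norm_form (\<lambda>u. m + x u) =
     at_cosets (linear_norm 1) (\<lambda>p. 4 * m + char_sum 1 1 x p) *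
     at_cosets (linear_norm (- 1)) (char_sum 1 (- 1) x) *
     (at_cosets (reduced_norm 1) (char_sum (- 1) 1 x))\<^sup>2 *
     (at_cosets (reduced_norm (- 1)) (char_sum (- 1) (- 1) x))\<^sup>2"
    by (simp add: norm_form_def algebra_simps)
  then show ?thesis
    by (simp only: linear_norm_add_const cofactor_def coefficient_sum_def mult.assoc)
qed

definition signed_indicator ::
  "(nat \<times> nat \<times> nat) set \<Rightarrow> (nat \<times> nat \<times> nat) set \<Rightarrow> nat \<times> nat \<times> nat \<Rightarrow> int" where
  "signed_indicator P Q u = of_bool (u \<in> P) - of_bool (u \<in> Q)"

text \<open>
  On the line through the unit element the cofactor is 1.  At the other four points it is
  \<open>2 ^ 12\<close> up to sign, so that the values on the line proceed in steps of \<open>2 ^ 16\<close>, and one line is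
  needed for each residue class of \<open>k\<close> modulo 4 in \<open>2 ^ 14 k\<close>.  With the sign taken into account,
  the coefficient sums 0, 8, 4 and 4 give the classes 0, 2, 1 and 3.  The points are taken where
  the sums over the first two cosets have opposite parity: only there \<open>2 ^ 14\<close> can be attained, as
  otherwise the bounds on the four factors multiply to \<open>2 ^ 16\<close>.
\<close>

lemma coefficient_sum_values:
  "coefficient_sum (signed_indicator {(0, 0, 0)} {}) = 1"
  "coefficient_sum (signed_indicator {(0, 0, 0), (0, 0, 1)} {(0, 1, 0), (0, 1, 2)}) = 0"
  "coefficient_sum (signed_indicator
     {(0, 0, 0), (1, 0, 0), (0, 1, 0), (0, 0, 1), (0, 1, 1), (0, 0, 2), (1, 0, 2), (0, 0, 3)} {}) = 8"
  "coefficient_sum (signed_indicator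
     {(0, 0, 0), (1, 0, 0), (0, 1, 0), (0, 0, 1), (0, 0, 2)} {(1, 1, 0)}) = 4"
  "coefficient_sum (signed_indicator
     {(0, 0, 0), (0, 1, 0), (0, 0, 1), (0, 0, 2), (1, 0, 3)} {(0, 1, 1)}) = 4"
  by (simp_all add: coefficient_sum_def signed_indicator_def)

lemma cofactor_values:
  "cofactor (signed_indicator {(0, 0, 0)} {}) = 1"
  "cofactor (signed_indicator {(0, 0, 0), (0, 0, 1)} {(0, 1, 0), (0, 1, 2)}) = - 4096"
  "cofactor (signed_indicator
     {(0, 0, 0), (1, 0, 0), (0, 1, 0), (0, 0, 1), (0, 1, 1), (0, 0, 2), (1, 0, 2), (0, 0, 3)} {}) = 4096"
  "cofactor (signed_indicator
     {(0, 0, 0), (1, 0, 0), (0, 1, 0), (0, 0, 1), (0, 0, 2)} {(1, 1, 0)}) = 4096"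
  "cofactor (signed_indicator
     {(0, 0, 0), (0, 1, 0), (0, 0, 1), (0, 0, 2), (1, 0, 3)} {(0, 1, 1)}) = - 4096"
  by (simp_all add: cofactor_def signed_indicator_def norm_simps)

theorem theorem1p1:
  shows "integer_group_dets C2xC2_C4 = {16 * m + 1 |m :: int. True} \<union> {2 ^ 14 * k |k :: int. True}"
proof
  show "integer_group_dets C2xC2_C4 \<subseteq> {16 * m + 1 |m :: int. True} \<union> {2 ^ 14 * k |k :: int. True}"
    unfolding integer_group_dets_C2xC2_C4 using norm_form_in by blast
next
  have line: "v \<in> range norm_form"
    if "coefficient_sum x = s" "cofactor x = k" "v = (16 * m + s) * k" for v s k m x
    unfolding that(3) that(1)[symmetric] that(2)[symmetric] norm_form_add_const[symmetric]
    by (rule rangeI)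
  have "16 * m + 1 \<in> range norm_form" for m
    by (rule line[OF coefficient_sum_values(1) cofactor_values(1), of _ m]) simp
  moreover have "2 ^ 14 * k \<in> range norm_form" for k
  proof -
    have "k = 4 * (k div 4) \<or> k = 4 * (k div 4) + 2 \<or> k = 4 * (k div 4) + 1 \<or>
        k = - (4 * (- (k div 4) - 1) + 1)"
      by presburger
    then obtain m where "k = 4 * m \<or> k = 4 * m + 2 \<or> k = 4 * m + 1 \<or> k = - (4 * m + 1)"
      by blast
    then show ?thesis
    proof (elim disjE)
      assume "k = 4 * m"
      then show ?thesis
        by (intro line[OF coefficient_sum_values(2) cofactor_values(2), of _ "- m"]) simp
    next
      assume "k = 4 * m + 2"
      then show ?thesis
        by (intro line[OF coefficient_sum_values(3) cofactor_values(3), of _ m]) simp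
    next
      assume "k = 4 * m + 1"
      then show ?thesis
        by (intro line[OF coefficient_sum_values(4) cofactor_values(4), of _ m]) simp
    next
      assume "k = - (4 * m + 1)"
      then show ?thesis
        by (intro line[OF coefficient_sum_values(5) cofactor_values(5), of _ m]) simp
    qed
  qed
  ultimately show "{16 * m + 1 |m :: int. True} \<union> {2 ^ 14 * k |k :: int. True} \<subseteq>
      integer_group_dets C2xC2_C4"
    unfolding integer_group_dets_C2xC2_C4 by blast
qed

end
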